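(* Let $\mathcal{M}=(S,s_I,\mathit{Act},V,\mathcal{P})$ be an affine pMDP, $T\subseteq S$ a set of target states, $\lambda\in[0,1]$, $\varepsilon_{\mathrm{graph}}>0$ and $\tau>0$. For each $s\in S\setminus T$ and $\alpha\in A(s)$ let $P_{s,\alpha}$, $q_{s,\alpha}$ be the matrix and vector of the quadratic function associated with $(s,\alpha)$ (defined in the context), and let $P^+_{s,\alpha}=P_{s,\alpha}+t_{s,\alpha}I$ and $P^-_{s,\alpha}=t_{s,\alpha}I$, where $t_{s,\alpha}>0$ is large enough that $P^+_{s,\alpha}$ is positive semidefinite. Let $\hat{x}\in\mathbb{R}^{|S|+|V|}$ be any point. Consider the convex optimization problem in the variables $\vec{x}=((p_s)_{s\in S},(v)_{v\in V})$, with $p_s\in[0,1]$ for all $s \in S$ and $v\in\mathbb{R}$ for all $v\in V$, together with penalty variables $k_{s,\alpha}\in\mathbb{R}$ for $s\in S\setminus T$, $\alpha\in A(s)$: $$\text{minimize}\quad p_{s_I}+\tau\sum_{s\in S\setminus T}\ \sum_{\alpha\in A(s)}k_{s,\alpha}$$ subject to - $p_s=1$ for all $s\in T$; - $\mathcal{P}(s,\alpha,s')\ge\varepsilon_{\mathrm{graph}}$ for all $s,s'\in S$ and $\alpha\in A(s)$ such that $\mathcal{P}(s,\alpha,s')$ is not the zero polynomial; - $\sum_{s'\in S}\mathcal{P}(s,\alpha,s')=1$ for all $s\in S$, $\alpha\in A(s)$; - $\lambda\ge p_{s_I}$; - $k_{s,\alpha}+p_s\ \ge\ \vec{x}^{T}P^+_{s,\alpha}\vec{x}+q_{s,\alpha}^{T}\vec{x}-\hat{x}^{T}P^-_{s,\alpha}(2\vec{x}-\hat{x})$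 for all $s\in S\setminus T$, $\alpha\in A(s)$; - $k_{s,\alpha}\ge 0$ for all $s\in S\setminus T$, $\alpha\in A(s)$. Here the functions $\mathcal{P}(s,\alpha,s')$ are evaluated at the values of the variables $v\in V$. Suppose an assignment of the variables satisfies all of these constraints and $$\tau\sum_{s\in S\setminus T}\ \sum_{\alpha\in A(s)}k_{s,\alpha}=0.$$ Let $u\colon V\to\mathbb{R}$ be the instantiation given by the values of the parameters $v\in V$ in this assignment. Then $u$ is well-defined for $\mathcal{M}$ and $\mathcal{M}[u]\models\mathbb{P}_{\le\lambda}(\lozenge T)$; that is, for every strategy $\sigma$ of $\mathcal{M}[u]$, the probability of reaching $T$ from $s_I$ in the induced Markov chain $\mathcal{M}[u]^\sigma$ is at most $\lambda$.
   Context: A parametric Markov decision process (pMDP) is a tuple $\mathcal{M}=(S,s_I,\mathit{Act},V,\mathcal{P})$ with a finite set $S$ of states, an initial state $s_I\in S$, a finite set $\mathit{Act}$ of actions, a finite set $V$ of real-valued variables (parameters), and a transition function $\mathcal{P}\colon S\times\mathit{Act}\times S\to\mathbb{Q}[V]$, where $\mathbb{Q}[V]$ is the set of multivariate polynomials over $V$. It is affine if every $\mathcal{P}(s,\alpha,s')$ is an affine function of the parameters. The set of enabled actions at $s$ is $A(s)=\{\alpha\in\mathit{Act}\mid\exists s'\in S.\ \mathcal{P}(s,\alpha,s')\neq 0\}$ (nonzero as a polynomial), and $A(s)\neq\emptyset$ is assumed for every $s$. A pMDP is an MDP if $\mathcal{P}$ takes values in $[0,1]$ and $\sum_{s'\in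 S}\mathcal{P}(s,\alpha,s')=1$ for all $s\in S$, $\alpha\in A(s)$. An instantiation is a function $u\colon V\to\mathbb{R}$; $\mathcal{M}[u]$ is obtained by replacing each polynomial $f$ in $\mathcal{P}$ by its value $f[u]$. The instantiation $u$ is well-defined for $\mathcal{M}$ if $\mathcal{M}[u]$ is an MDP. A strategy is a function $\sigma\colon S\to\mathit{Act}$ with $\sigma(s)\in A(s)$ (memoryless deterministic). Applying $\sigma$ to an MDP yields the induced Markov chain with transition probabilities $\mathcal{P}(s,\sigma(s),s')$. An MDP satisfies $\mathbb{P}_{\le\lambda}(\lozenge T)$ if under all strategies the probability of eventually reaching $T$ from $s_I$ in the induced Markov chain is at most $\lambda$. Matrices and vectors: the vector $\vec{x}$ has $|S|+|V|$ entries, indexed by the probability variables $p_s$ ($s\in S$) and the parameters $v\in V$. For $s\in S\setminus T$ and $\alpha\in A(s)$, write $\mathcal{P}(s,\alpha,s')=\sum_{v\in V}a_{s',v}\,v+b_{s'}$. Then $P_{s,\alpha}$ is the symmetric $(|S|+|V|)\times(|S|+|V|)$ matrix whose entries at $(v,p_{s'})$ and $(p_{s'},v)$ are $a_{s',v}/2$ and all of whose other entries are $0$, and $q_{s,\alpha}$ is the vector whose entry at $p_{s'}$ is $b_{s'}$ and whose entries at parameters are $0$. Thus $\vec{x}^TP_{s,\alpha}\vec{x}+q_{s,\alpha}^T\vec{x}=\sum_{s'\in S}\mathcal{P}(s,\alpha,s')\cdot p_{s'}$. $I$ denotes the identity matrix. *)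

theory Defs
  imports "HOL-Probability.Probability" "HOL-Library.Poly_Mapping"
begin

section \<open>Multivariate polynomials with rational coefficients\<close>

text \<open>
  A monomial is a finitely supported exponent map, and a polynomial is a finitely supported
  map from monomials to coefficients. Zero is the zero polynomial.
\<close>

type_synonym 'v rpoly = "('v \<Rightarrow>\<^sub>0 nat) \<Rightarrow>\<^sub>0 rat"

definition poly_vars :: "'v rpoly \<Rightarrow> 'v set" where
  "poly_vars f = (\<Union>m\<in>Poly_Mapping.keys f. Poly_Mapping.keys m)"

definition poly_value :: "('v \<Rightarrow> real) \<Rightarrow> 'v rpoly \<Rightarrow> real" where
  "poly_value u f =
     (\<Sum>m\<in>Poly_Mapping.keys f. of_rat (Poly_Mapping.lookup f m) *
        (\<Prod>v\<in>Poly_Mapping.keys m. u v ^ Poly_Mapping.lookup m v))"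

definition affine_poly :: "'v rpoly \<Rightarrow> bool" where
  "affine_poly f \<longleftrightarrow>
     (\<forall>m\<in>Poly_Mapping.keys f. (\<Sum>v\<in>Poly_Mapping.keys m. Poly_Mapping.lookup m v) \<le> 1)"

definition lin_coeff :: "'v rpoly \<Rightarrow> 'v \<Rightarrow> real" where
  "lin_coeff f v = of_rat (Poly_Mapping.lookup f (Poly_Mapping.single v 1))"

definition const_coeff :: "'v rpoly \<Rightarrow> real" where
  "const_coeff f = of_rat (Poly_Mapping.lookup f 0)"

section \<open>(Parametric) Markov decision processes\<close>

text \<open>
  The carriers are explicit sets, so that the set of parameters may be empty. The coefficient type
  is \<^typ>\<open>'v rpoly\<close> for parametric MDPs and \<^typ>\<open>real\<close> for their instantiations.
\<close>

record ('s, 'a, 'c) decision_process =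
  states :: "'s set"
  init :: 's
  acts :: "'a set"
  transf :: "'s \<Rightarrow> 'a \<Rightarrow> 's \<Rightarrow> 'c"

record ('s, 'a, 'v) pmdp = "('s, 'a, 'v rpoly) decision_process" +
  params :: "'v set"

definition enabled :: "('s, 'a, 'c::zero, 'z) decision_process_scheme \<Rightarrow> 's \<Rightarrow> 'a set" where
  "enabled M s = {\<alpha> \<in> acts M. \<exists>s'\<in>states M. transf M s \<alpha> s' \<noteq> 0}"

definition wf_process :: "('s, 'a, 'c::zero, 'z) decision_process_scheme \<Rightarrow> bool" where
  "wf_process M \<longleftrightarrow> finite (states M) \<and> init M \<in> states M \<and> finite (acts M) \<and>
     (\<forall>s\<in>states M. enabled M s \<noteq> {})"

definition is_pmdp :: "('s, 'a, 'v) pmdp \<Rightarrow> bool" where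
  "is_pmdp M \<longleftrightarrow> wf_process M \<and> finite (params M) \<and>
     (\<forall>s\<in>states M. \<forall>\<alpha>\<in>acts M. \<forall>s'\<in>states M. poly_vars (transf M s \<alpha> s') \<subseteq> params M)"

definition affine_pmdp :: "('s, 'a, 'v) pmdp \<Rightarrow> bool" where
  "affine_pmdp M \<longleftrightarrow> is_pmdp M \<and>
     (\<forall>s\<in>states M. \<forall>\<alpha>\<in>acts M. \<forall>s'\<in>states M. affine_poly (transf M s \<alpha> s'))"

definition is_mdp :: "('s, 'a, real) decision_process \<Rightarrow> bool" where
  "is_mdp D \<longleftrightarrow> wf_process D \<and>
     (\<forall>s\<in>states D. \<forall>\<alpha>\<in>acts D. \<forall>s'\<in>states D. transf D s \<alpha> s' \<in> {0..1}) \<and>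
     (\<forall>s\<in>states D. \<forall>\<alpha>\<in>enabled D s. (\<Sum>s'\<in>states D. transf D s \<alpha> s') = 1)"

definition inst :: "('s, 'a, 'v) pmdp \<Rightarrow> ('v \<Rightarrow> real) \<Rightarrow> ('s, 'a, real) decision_process" where
  "inst M u = \<lparr>states = states M, init = init M, acts = acts M,
     transf = (\<lambda>s \<alpha> s'. poly_value u (transf M s \<alpha> s'))\<rparr>"

definition well_defined :: "('s, 'a, 'v) pmdp \<Rightarrow> ('v \<Rightarrow> real) \<Rightarrow> bool" where
  "well_defined M u \<longleftrightarrow> is_mdp (inst M u)"

definition strategy :: "('s, 'a, real) decision_process \<Rightarrow> ('s \<Rightarrow> 'a) \<Rightarrow> bool" where
  "strategy D \<sigma> \<longleftrightarrow> (\<forall>s\<in>states D. \<sigma> s \<in> enabled D s)"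

section \<open>Markov chains and reachability probabilities\<close>

definition induced_chain :: "('s, 'a, real) decision_process \<Rightarrow> ('s \<Rightarrow> 'a) \<Rightarrow> 's \<Rightarrow> 's \<Rightarrow> real" where
  "induced_chain D \<sigma> s s' = transf D s (\<sigma> s) s'"

definition is_chain :: "'s set \<Rightarrow> ('s \<Rightarrow> 's \<Rightarrow> real) \<Rightarrow> bool" where
  "is_chain S K \<longleftrightarrow> finite S \<and> (\<forall>s\<in>S. \<forall>s'\<in>S. 0 \<le> K s s') \<and> (\<forall>s\<in>S. (\<Sum>s'\<in>S. K s s') = 1)"

text \<open>
  The distribution of the state at time \<open>n\<close> given the states \<open>\<omega> 0, \<dots>, \<omega> (n - 1)\<close>, and the
  measure it induces on infinite paths by the theorem of Ionescu-Tulcea.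
\<close>

definition step_kernel :: "'s set \<Rightarrow> ('s \<Rightarrow> 's \<Rightarrow> real) \<Rightarrow> 's \<Rightarrow> nat \<Rightarrow> (nat \<Rightarrow> 's) \<Rightarrow> 's measure" where
  "step_kernel S K s0 n \<omega> =
     (if n = 0 then return (count_space S) s0
      else point_measure S (\<lambda>s'. ennreal (K (\<omega> (n - 1)) s')))"

definition path_measure :: "'s set \<Rightarrow> ('s \<Rightarrow> 's \<Rightarrow> real) \<Rightarrow> 's \<Rightarrow> (nat \<Rightarrow> 's) measure" where
  "path_measure S K s0 =
     projective_family.lim UNIV
       (Ionescu_Tulcea.CI (step_kernel S K s0) (\<lambda>_. count_space S)) (\<lambda>_. count_space S)"

definition reach_prob :: "'s set \<Rightarrow> ('s \<Rightarrow> 's \<Rightarrow> real) \<Rightarrow> 's \<Rightarrow> 's set \<Rightarrow> real" where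
  "reach_prob S K s0 T =
     Sigma_Algebra.measure (path_measure S K s0)
       {\<omega> \<in> space (path_measure S K s0). \<exists>n. \<omega> n \<in> T}"

definition sat_reach_le :: "('s, 'a, real) decision_process \<Rightarrow> real \<Rightarrow> 's set \<Rightarrow> bool" where
  "sat_reach_le D lam T \<longleftrightarrow>
     (\<forall>\<sigma>. strategy D \<sigma> \<longrightarrow> reach_prob (states D) (induced_chain D \<sigma>) (init D) T \<le> lam)"

lemma Ionescu_Tulcea_step_kernel:
  fixes S :: "'s set"
  assumes "is_chain S K" "s0 \<in> S"
  shows "Ionescu_Tulcea (step_kernel S K s0) (\<lambda>_. count_space S)"
proof -
  have fin: "finite S" and nn: "\<And>s s'. s \<in> S \<Longrightarrow> s' \<in> S \<Longrightarrow> 0 \<le> K s s'"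
    and sm: "\<And>s. s \<in> S \<Longrightarrow> (\<Sum>s'\<in>S. K s s') = 1"
    using assms by (auto simp: is_chain_def)
  have prob: "prob_space (point_measure S (\<lambda>s'. ennreal (K s s')))" if "s \<in> S" for s
  proof (rule prob_spaceI)
    have "emeasure (point_measure S (\<lambda>s'. ennreal (K s s'))) S = (\<Sum>s'\<in>S. ennreal (K s s'))"
      using fin by (simp add: emeasure_point_measure_finite)
    also have "\<dots> = ennreal (\<Sum>s'\<in>S. K s s')"
      using that nn by (intro sum_ennreal) auto
    finally show "emeasure (point_measure S (\<lambda>s'. ennreal (K s s')))
        (space (point_measure S (\<lambda>s'. ennreal (K s s')))) = 1"
      using that sm by (simp add: space_point_measure)
  qed
  show ?thesis
  proof (rule Ionescu_Tulcea.intro)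
    fix n
    show "step_kernel S K s0 n
        \<in> measurable (PiM {0..<n} (\<lambda>_. count_space S)) (subprob_algebra (count_space S))"
    proof (cases n)
      case 0
      then show ?thesis
        using assms(2) by (simp add: step_kernel_def[abs_def] prob_space_return
            measurable_const prob_space_imp_subprob_space space_subprob_algebra)
    next
      case (Suc m)
      have "(\<lambda>s. point_measure S (\<lambda>s'. ennreal (K s s')))
          \<in> measurable (count_space S) (subprob_algebra (count_space S))"
        using prob by (auto simp: space_subprob_algebra sets_point_measure
            prob_space_imp_subprob_space)
      moreover have "(\<lambda>\<omega>. \<omega> m) \<in> measurable (PiM {0..<n} (\<lambda>_. count_space S)) (count_space S)"
        using Suc by (intro measurable_component_singleton) auto
      ultimately have "(\<lambda>\<omega>. point_measure S (\<lambda>s'. ennreal (K (\<omega> m) s')))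
          \<in> measurable (PiM {0..<n} (\<lambda>_. count_space S)) (subprob_algebra (count_space S))"
        by (rule measurable_compose[rotated])
      then show ?thesis using Suc by (simp add: step_kernel_def[abs_def])
    qed
  next
    fix n and \<omega> :: "nat \<Rightarrow> 's"
    assume "\<omega> \<in> space (PiM {0..<n} (\<lambda>_. count_space S))"
    then show "prob_space (step_kernel S K s0 n \<omega>)"
      using prob assms(2)
      by (cases n) (auto simp: step_kernel_def space_PiM PiE_iff prob_space_return)
  qed
qed

section \<open>Vectors and matrices over a finite index set\<close>

definition dot :: "'i set \<Rightarrow> ('i \<Rightarrow> real) \<Rightarrow> ('i \<Rightarrow> real) \<Rightarrow> real" where
  "dot J x y = (\<Sum>i\<in>J. x i * y i)"

definition mat_vec :: "'i set \<Rightarrow> ('i \<Rightarrow> 'i \<Rightarrow> real) \<Rightarrow> ('i \<Rightarrow> real) \<Rightarrow> 'i \<Rightarrow> real" where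
  "mat_vec J A x = (\<lambda>i. \<Sum>j\<in>J. A i j * x j)"

definition scaled_id :: "real \<Rightarrow> 'i \<Rightarrow> 'i \<Rightarrow> real" where
  "scaled_id t i j = (if i = j then t else 0)"

definition pos_semidef :: "'i set \<Rightarrow> ('i \<Rightarrow> 'i \<Rightarrow> real) \<Rightarrow> bool" where
  "pos_semidef J A \<longleftrightarrow> (\<forall>i\<in>J. \<forall>j\<in>J. A i j = A j i) \<and> (\<forall>x. 0 \<le> dot J x (mat_vec J A x))"

section \<open>The quadratic functions of an affine pMDP\<close>

text \<open>The entry \<open>Inl s\<close> of a vector is that of \<open>p\<^sub>s\<close>; the entry \<open>Inr v\<close> is that of the parameter \<open>v\<close>.\<close>

definition qp_index :: "('s, 'a, 'v) pmdp \<Rightarrow> ('s + 'v) set" where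
  "qp_index M = states M <+> params M"

definition P_mat :: "('s, 'a, 'v) pmdp \<Rightarrow> 's \<Rightarrow> 'a \<Rightarrow> 's + 'v \<Rightarrow> 's + 'v \<Rightarrow> real" where
  "P_mat M s \<alpha> i j =
     (case (i, j) of
        (Inr v, Inl s') \<Rightarrow> lin_coeff (transf M s \<alpha> s') v / 2
      | (Inl s', Inr v) \<Rightarrow> lin_coeff (transf M s \<alpha> s') v / 2
      | _ \<Rightarrow> 0)"

definition q_vec :: "('s, 'a, 'v) pmdp \<Rightarrow> 's \<Rightarrow> 'a \<Rightarrow> 's + 'v \<Rightarrow> real" where
  "q_vec M s \<alpha> i = (case i of Inl s' \<Rightarrow> const_coeff (transf M s \<alpha> s') | Inr v \<Rightarrow> 0)"

definition P_plus :: "('s, 'a, 'v) pmdp \<Rightarrow> real \<Rightarrow> 's \<Rightarrow> 'a \<Rightarrow> 's + 'v \<Rightarrow> 's + 'v \<Rightarrow> real" where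
  "P_plus M t s \<alpha> i j = P_mat M s \<alpha> i j + scaled_id t i j"

definition P_minus :: "real \<Rightarrow> 's + 'v \<Rightarrow> 's + 'v \<Rightarrow> real" where
  "P_minus t = scaled_id t"

end

theory Submission
  imports Defs
begin

text \<open>
  With all penalties zero, convexifying \<open>P\<close> by \<open>t I\<close> and linearizing \<open>-t \<parallel>x\<parallel>\<^sup>2\<close> at \<open>xhat\<close> only adds
  the slack \<open>t \<parallel>x - xhat\<parallel>\<^sup>2\<close>, so any feasible point satisfies the original Bellman inequalities
  \<open>p\<^sub>s \<ge> (\<Sum>s'. \<P>(s,\<alpha>,s') p\<^sub>s')\<close>. Hence, along any induced chain, the process that follows \<open>p\<close> until \<open>T\<close>
  is hit and equals 1 afterwards is a nonnegative supermartingale starting at \<open>p\<^sub>s\<close> of the initial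
  state; its expectation at time \<open>n\<close> dominates the probability of hitting \<open>T\<close> before time \<open>n\<close>.
\<close>

section \<open>Affine polynomials\<close>

text \<open>Exponents are natural numbers, so a nonzero monomial of total degree at most 1 has one
  variable with exponent 1 and nothing left over for any other variable.\<close>

lemma affine_poly_keys:
  assumes "affine_poly f"
  shows "Poly_Mapping.keys f \<subseteq> insert 0 ((\<lambda>v. Poly_Mapping.single v 1) ` poly_vars f)"
proof
  fix m assume m: "m \<in> Poly_Mapping.keys f"
  with assms have le: "(\<Sum>v\<in>Poly_Mapping.keys m. Poly_Mapping.lookup m v) \<le> 1"
    by (simp add: affine_poly_def)
  show "m \<in> insert 0 ((\<lambda>v. Poly_Mapping.single v 1) ` poly_vars f)"
  proof (cases "m = 0")
    case False
    then obtain v where v: "v \<in> Poly_Mapping.keys m"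
      by fastforce
    have split: "(\<Sum>w\<in>Poly_Mapping.keys m. Poly_Mapping.lookup m w) =
        Poly_Mapping.lookup m v + (\<Sum>w\<in>Poly_Mapping.keys m - {v}. Poly_Mapping.lookup m w)"
      using v by (intro sum.remove) auto
    have pos: "Poly_Mapping.lookup m v \<noteq> 0"
      using v by (simp add: in_keys_iff)
    with le split have one: "Poly_Mapping.lookup m v = 1"
      and "(\<Sum>w\<in>Poly_Mapping.keys m - {v}. Poly_Mapping.lookup m w) = 0"
      by linarith+
    then have "\<forall>w\<in>Poly_Mapping.keys m - {v}. Poly_Mapping.lookup m w = 0"
      by simp
    then have "Poly_Mapping.lookup m w = Poly_Mapping.lookup (Poly_Mapping.single v 1) w" for w
      using one by (cases "w = v") (auto simp: lookup_single in_keys_iff)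
    then have "m = Poly_Mapping.single v 1"
      by (rule poly_mapping_eqI)
    moreover have "v \<in> poly_vars f"
      using m v by (auto simp: poly_vars_def)
    ultimately show ?thesis by blast
  qed simp
qed

lemma poly_value_affine:
  assumes "affine_poly f" "poly_vars f \<subseteq> V" "finite V"
  shows "poly_value u f = (\<Sum>v\<in>V. lin_coeff f v * u v) + const_coeff f"
proof -
  let ?e = "\<lambda>v. Poly_Mapping.single v (1::nat)"
  let ?h = "\<lambda>m. of_rat (Poly_Mapping.lookup f m) *
        (\<Prod>v\<in>Poly_Mapping.keys m. u v ^ Poly_Mapping.lookup m v)"
  have inj: "inj_on ?e V"
    by (rule inj_onI) (metis keys_single one_neq_zero singleton_inject)
  have z: "0 \<notin> ?e ` V"
    by (metis (mono_tags, lifting) imageE keys_single keys_zero one_neq_zero insert_not_empty)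
  \<comment> \<open>The sum is widened from the keys of \<open>f\<close> to all monomials of degree
    at most 1 over \<open>V\<close>. The added monomials have coefficient 0.\<close>
  have "poly_value u f = sum ?h (insert 0 (?e ` V))"
    unfolding poly_value_def
    using affine_poly_keys[OF assms(1)] assms(2,3)
    by (intro sum.mono_neutral_left) (auto simp: in_keys_iff)
  also have "\<dots> = ?h 0 + sum ?h (?e ` V)"
    using z assms(3) by (intro sum.insert) auto
  also have "sum ?h (?e ` V) = (\<Sum>v\<in>V. ?h (?e v))"
    by (rule sum.reindex[OF inj, unfolded comp_def])
  also have "\<dots> = (\<Sum>v\<in>V. lin_coeff f v * u v)"
    by (intro sum.cong) (auto simp: lin_coeff_def)
  finally show ?thesis
    by (simp add: const_coeff_def)
qed

lemma poly_value_zero [simp]: "poly_value u 0 = 0"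
  by (simp add: poly_value_def)

section \<open>The quadratic constraints\<close>

lemma mat_vec_scaled_id:
  assumes "finite J" "i \<in> J"
  shows "mat_vec J (scaled_id t) x i = t * x i"
proof -
  have "mat_vec J (scaled_id t) x i = (\<Sum>j\<in>J. if i = j then t * x j else 0)"
    unfolding mat_vec_def scaled_id_def by (intro sum.cong) auto
  then show ?thesis using assms by simp
qed

lemma dot_scaled_id:
  assumes "finite J"
  shows "dot J x (mat_vec J (scaled_id t) y) = t * dot J x y"
  using assms by (simp add: dot_def mat_vec_scaled_id sum_distrib_left mult.left_commute)

lemma mat_vec_P_plus:
  "mat_vec J (P_plus M t s \<alpha>) x i = mat_vec J (P_mat M s \<alpha>) x i + mat_vec J (scaled_id t) x i"
  by (simp add: mat_vec_def P_plus_def sum.distrib ring_distribs)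

lemma dot_P_mat:
  assumes "finite (states M)" "finite (params M)"
  shows "dot (qp_index M) x (mat_vec (qp_index M) (P_mat M s \<alpha>) x) =
     (\<Sum>s'\<in>states M. \<Sum>v\<in>params M. lin_coeff (transf M s \<alpha> s') v * x (Inr v) * x (Inl s'))"
    (is "?lhs = ?rhs")
proof -
  let ?S = "states M" and ?V = "params M"
  let ?l = "\<lambda>s' v. lin_coeff (transf M s \<alpha> s') v"
  have "?lhs = (\<Sum>s'\<in>?S. x (Inl s') * (\<Sum>v\<in>?V. ?l s' v / 2 * x (Inr v)))
      + (\<Sum>v\<in>?V. x (Inr v) * (\<Sum>s'\<in>?S. ?l s' v / 2 * x (Inl s')))"
    using assms by (simp add: dot_def mat_vec_def qp_index_def P_mat_def sum.Plus)
  \<comment> \<open>Swapping the second double sum gives both the same order of summation, so that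
    the two halves of each coefficient add up termwise.\<close>
  also have "\<dots> = (\<Sum>s'\<in>?S. \<Sum>v\<in>?V. x (Inl s') * (?l s' v / 2 * x (Inr v)))
      + (\<Sum>s'\<in>?S. \<Sum>v\<in>?V. x (Inr v) * (?l s' v / 2 * x (Inl s')))"
    by (subst (2) sum.swap) (simp add: sum_distrib_left)
  also have "\<dots> = ?rhs"
    unfolding sum.distrib[symmetric] by (intro sum.cong refl) (simp add: field_simps)
  finally show ?thesis .
qed

lemma dot_q_vec:
  assumes "finite (states M)" "finite (params M)"
  shows "dot (qp_index M) (q_vec M s \<alpha>) x =
    (\<Sum>s'\<in>states M. const_coeff (transf M s \<alpha> s') * x (Inl s'))"
  using assms by (simp add: dot_def qp_index_def q_vec_def sum.Plus)

text \<open>The parts with \<open>P_mat\<close> and \<open>q_vec\<close> form the Bellman sum. In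
  the remaining parts the factor \<open>t\<close> multiplies |x|^2 - 2 xhat.x + |xhat|^2, a complete
  square.\<close>

lemma convexified_constraint_eq:
  assumes M: "affine_pmdp M" and s: "s \<in> states M" and \<alpha>: "\<alpha> \<in> acts M"
  shows "dot (qp_index M) x (mat_vec (qp_index M) (P_plus M t s \<alpha>) x)
       + dot (qp_index M) (q_vec M s \<alpha>) x
       - dot (qp_index M) xhat (mat_vec (qp_index M) (P_minus t) (\<lambda>i. 2 * x i - xhat i))
     = (\<Sum>s'\<in>states M. poly_value (x \<circ> Inr) (transf M s \<alpha> s') * x (Inl s'))
       + t * (\<Sum>i\<in>qp_index M. (x i - xhat i)\<^sup>2)"
proof -
  let ?J = "qp_index M"
  have finS: "finite (states M)" and finV: "finite (params M)"
    using M by (auto simp: affine_pmdp_def is_pmdp_def wf_process_def)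
  then have finJ: "finite ?J" by (simp add: qp_index_def)
  have val: "poly_value (x \<circ> Inr) (transf M s \<alpha> s') =
      (\<Sum>v\<in>params M. lin_coeff (transf M s \<alpha> s') v * x (Inr v)) + const_coeff (transf M s \<alpha> s')"
    if "s' \<in> states M" for s'
    using M s \<alpha> that finV
    by (subst poly_value_affine[where V = "params M"]) (auto simp: affine_pmdp_def is_pmdp_def)
  have "(\<Sum>s'\<in>states M. poly_value (x \<circ> Inr) (transf M s \<alpha> s') * x (Inl s'))
      = dot ?J x (mat_vec ?J (P_mat M s \<alpha>) x) + dot ?J (q_vec M s \<alpha>) x"
    using finS finV
    by (simp add: val dot_P_mat dot_q_vec sum.distrib[symmetric] sum_distrib_right ring_distribs)
  moreover have "dot ?J x (mat_vec ?J (P_plus M t s \<alpha>) x) =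
      dot ?J x (mat_vec ?J (P_mat M s \<alpha>) x) + dot ?J x (mat_vec ?J (scaled_id t) x)"
    by (simp add: dot_def mat_vec_P_plus sum.distrib ring_distribs)
  moreover have "dot ?J x x - dot ?J xhat (\<lambda>i. 2 * x i - xhat i) = (\<Sum>i\<in>?J. (x i - xhat i)\<^sup>2)"
    unfolding dot_def sum_subtractf[symmetric]
    by (intro sum.cong) (auto simp: power2_eq_square algebra_simps)
  then have "t * dot ?J x x - t * dot ?J xhat (\<lambda>i. 2 * x i - xhat i)
      = t * (\<Sum>i\<in>?J. (x i - xhat i)\<^sup>2)"
    by (simp add: right_diff_distrib[symmetric])
  ultimately show ?thesis
    using finJ by (simp add: P_minus_def dot_scaled_id)
qed

section \<open>Reachability probabilities of Markov chains\<close>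

text \<open>Here \<open>n\<close> counts the states already drawn, \<open>\<omega> 0\<close> to
  \<open>\<omega> (n - 1)\<close>, so the current state is the last of these. Before the first draw,
  \<open>s0\<close> stands in for it.\<close>

definition stopped_value :: "'s set \<Rightarrow> ('s \<Rightarrow> real) \<Rightarrow> 's \<Rightarrow> nat \<Rightarrow> (nat \<Rightarrow> 's) \<Rightarrow> ennreal" where
  "stopped_value T p s0 n \<omega> =
     (if \<exists>i<n. \<omega> i \<in> T then 1 else ennreal (p (if n = 0 then s0 else \<omega> (n - 1))))"

text \<open>This is the supermartingale inequality for one draw: the prefix \<open>\<omega>\<close>
  is fixed and only coordinate \<open>n\<close> is integrated.\<close>

lemma nn_integral_step_kernel_le:
  fixes S T :: "'s set" and p :: "'s \<Rightarrow> real"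
  assumes chain: "is_chain S K" and s0: "s0 \<in> S"
    and nonneg: "\<And>s. s \<in> S \<Longrightarrow> 0 \<le> p s"
    and target: "\<And>s. s \<in> T \<Longrightarrow> p s = 1"
    and bellman: "\<And>s. s \<in> S - T \<Longrightarrow> (\<Sum>s'\<in>S. K s s' * p s') \<le> p s"
    and \<omega>: "\<omega> \<in> space (PiM {0..<n} (\<lambda>_. count_space S))"
  shows "(\<integral>\<^sup>+s. stopped_value T p s0 (Suc n) (fun_upd \<omega> n s) \<partial>step_kernel S K s0 n \<omega>)
      \<le> stopped_value T p s0 n \<omega>"
proof -
  have finS: "finite S" and K: "\<And>s s'. s \<in> S \<Longrightarrow> s' \<in> S \<Longrightarrow> 0 \<le> K s s'"
    using chain by (auto simp: is_chain_def)
  interpret Ionescu_Tulcea "step_kernel S K s0" "\<lambda>_. count_space S"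
    by (rule Ionescu_Tulcea_step_kernel[OF chain s0])
  interpret prob_space "step_kernel S K s0 n \<omega>"
    by (rule prob_space_P[OF \<omega>])
  show ?thesis
  proof (cases "\<exists>i<n. \<omega> i \<in> T")
    case True
    then have "stopped_value T p s0 (Suc n) (fun_upd \<omega> n s) = 1" for s
      unfolding stopped_value_def using less_Suc_eq by fastforce
    then show ?thesis
      using True by (simp add: stopped_value_def emeasure_space_1)
  next
    case False
    \<comment> \<open>Since \<open>p\<close> is 1 on \<open>T\<close>, the value is
      \<open>p s\<close> whether or not the new state \<open>s\<close> is the first to hit
      \<open>T\<close>.\<close>
    then have h: "stopped_value T p s0 (Suc n) (fun_upd \<omega> n s) = ennreal (p s)" for s
      using target by (auto simp: stopped_value_def less_Suc_eq)
    show ?thesis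
    proof (cases n)
      \<comment> \<open>The first draw is the point mass at \<open>s0\<close>, so the value stays at
        \<open>p s0\<close>.\<close>
      case 0
      then show ?thesis
        unfolding h using s0 by (simp add: step_kernel_def nn_integral_return stopped_value_def)
    next
      case (Suc m)
      with \<omega> have m: "\<omega> m \<in> S"
        by (auto simp: space_PiM)
      have "(\<integral>\<^sup>+s. ennreal (p s) \<partial>step_kernel S K s0 n \<omega>)
          = (\<Sum>s\<in>S. ennreal (K (\<omega> m) s) * ennreal (p s))"
        using Suc finS by (simp add: step_kernel_def nn_integral_point_measure_finite)
      also have "\<dots> = ennreal (\<Sum>s\<in>S. K (\<omega> m) s * p s)"
        using K[OF m] nonneg by (simp add: sum_ennreal ennreal_mult[symmetric])
      \<comment> \<open>The current state \<open>\<omega> m\<close> lies outside \<open>T\<close>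
        because no earlier draw has hit it, so the Bellman inequality applies.\<close>
      also have "\<dots> \<le> ennreal (p (\<omega> m))"
        using Suc m False by (intro ennreal_leI bellman) auto
      finally show ?thesis
        unfolding h using Suc False by (auto simp: stopped_value_def)
    qed
  qed
qed

text \<open>The same bound \<open>p s0\<close> holds for every finite horizon, and the events of
  hitting \<open>T\<close> before time \<open>n\<close> increase to the event of ever hitting
  it.\<close>

lemma reach_prob_le_supersolution:
  fixes S T :: "'s set" and p :: "'s \<Rightarrow> real"
  assumes chain: "is_chain S K" and s0: "s0 \<in> S"
    and nonneg: "\<And>s. s \<in> S \<Longrightarrow> 0 \<le> p s"
    and target: "\<And>s. s \<in> T \<Longrightarrow> p s = 1"
    and bellman: "\<And>s. s \<in> S - T \<Longrightarrow> (\<Sum>s'\<in>S. K s s' * p s') \<le> p s"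
  shows "reach_prob S K s0 T \<le> p s0"
proof -
  let ?M = "\<lambda>_::nat. count_space S"
  interpret Ionescu_Tulcea "step_kernel S K s0" ?M
    by (rule Ionescu_Tulcea_step_kernel[OF chain s0])
  let ?h = "stopped_value T p s0"
  \<comment> \<open>A finite product of finite discrete spaces is discrete, which settles all
    measurability questions about prefixes.\<close>
  have PiM_eq: "PiM {0..<n} ?M = count_space (\<Pi>\<^sub>E i\<in>{0..<n}. S)" for n :: nat
    using chain by (intro count_space_PiM_finite) (auto simp: is_chain_def intro: countable_finite)
  have meas: "?h n \<in> borel_measurable (PiM {0..<n} ?M)" for n
    unfolding PiM_eq by simp
  have start: "(\<lambda>_. undefined) \<in> space (PiM {0..<0::nat} ?M)"
    by (simp add: space_PiM)
  have int: "(\<integral>\<^sup>+\<omega>. ?h n \<omega> \<partial>C 0 n (\<lambda>_. undefined)) \<le> ennreal (p s0)" for n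
  proof (induction n)
    case 0
    then show ?case
      using start meas[of 0] by (simp add: nn_integral_return) (simp add: stopped_value_def)
  next
    case (Suc n)
    \<comment> \<open>The law of prefixes of length \<open>Suc n\<close> is that of length
      \<open>n\<close> followed by \<open>eP n\<close>, which appends one state drawn from the
      kernel.\<close>
    have "(\<integral>\<^sup>+\<omega>. ?h (Suc n) \<omega> \<partial>C 0 (Suc n) (\<lambda>_. undefined))
        = (\<integral>\<^sup>+\<omega>. (\<integral>\<^sup>+\<omega>'. ?h (Suc n) \<omega>' \<partial>eP n \<omega>) \<partial>C 0 n (\<lambda>_. undefined))"
      using measurable_eP[of n] unfolding C.simps add_0
      by (intro nn_integral_bind[OF meas]) (simp add: measurable_cong_sets[OF sets_C[OF start] refl])
    also have "\<dots> \<le> (\<integral>\<^sup>+\<omega>. ?h n \<omega> \<partial>C 0 n (\<lambda>_. undefined))"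
    proof (intro nn_integral_mono)
      fix \<omega> assume "\<omega> \<in> space (C 0 n (\<lambda>_. undefined))"
      then have \<omega>: "\<omega> \<in> space (PiM {0..<n} ?M)"
        using start by (simp add: space_C)
      show "(\<integral>\<^sup>+\<omega>'. ?h (Suc n) \<omega>' \<partial>eP n \<omega>) \<le> ?h n \<omega>"
        using nn_integral_step_kernel_le[OF chain s0 nonneg target bellman \<omega>]
        by (simp add: nn_integral_eP[OF \<omega> meas])
    qed
    finally show ?case using Suc.IH by simp
  qed
  let ?H = "\<lambda>n. {\<omega> \<in> space (PiM {0..<n} ?M). \<exists>i<n. \<omega> i \<in> T}"
  let ?E = "\<lambda>n. {\<omega> \<in> space (PiM UNIV ?M). \<exists>i<n. \<omega> i \<in> T}"
  have H: "?H n \<in> sets (PiM {0..<n} ?M)" for n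
    unfolding PiM_eq by auto
  \<comment> \<open>The event depends on the first \<open>n\<close> coordinates only, so it is a
    cylinder and its measure can be computed on prefixes.\<close>
  have emb: "?E n = PF.emb UNIV {0..<n} (?H n)" for n
    by (auto simp: prod_emb_def space_PiM)
  have E: "?E n \<in> sets PF.lim" for n
    unfolding emb by (subst PF.sets_lim) (intro measurable_prod_emb H subset_UNIV)
  have "emeasure PF.lim (?E n) \<le> ennreal (p s0)" for n
  proof -
    have emb_id: "PF.emb {0..<n} {0..<n} (?H n) = ?H n"
      by (intro prod_emb_id) (auto simp: space_PiM)
    have "emeasure PF.lim (?E n) = emeasure (CI {0..<n}) (?H n)"
      unfolding emb by (rule lim[OF finite_atLeastLessThan H])
    also have "\<dots> = emeasure (C 0 n (\<lambda>_. undefined)) (?H n)"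
      using emeasure_CI[OF order_refl H[of n]] unfolding emb_id .
    also have "\<dots> = (\<integral>\<^sup>+\<omega>. indicator (?H n) \<omega> \<partial>C 0 n (\<lambda>_. undefined))"
      by (rule nn_integral_indicator[symmetric]) (unfold sets_C[OF start] add_0, rule H)
    \<comment> \<open>On \<open>?H n\<close> the stopped value is exactly 1.\<close>
    also have "\<dots> \<le> (\<integral>\<^sup>+\<omega>. ?h n \<omega> \<partial>C 0 n (\<lambda>_. undefined))"
      by (intro nn_integral_mono) (auto simp: stopped_value_def split: split_indicator)
    finally show ?thesis using int[of n] by simp
  qed
  then have "(SUP n. emeasure PF.lim (?E n)) \<le> ennreal (p s0)"
    by (rule SUP_least)
  moreover have "(SUP n. emeasure PF.lim (?E n)) = emeasure PF.lim (\<Union>n. ?E n)"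
  proof (rule SUP_emeasure_incseq)
    show "range ?E \<subseteq> sets PF.lim"
      by (intro image_subsetI E)
    show "incseq ?E"
      by (intro incseq_SucI) (blast intro: less_SucI)
  qed
  moreover have "(\<Union>n. ?E n) = {\<omega> \<in> space PF.lim. \<exists>n. \<omega> n \<in> T}"
    by auto
  ultimately have "emeasure PF.lim {\<omega> \<in> space PF.lim. \<exists>n. \<omega> n \<in> T} \<le> ennreal (p s0)"
    by simp
  then show ?thesis
    unfolding reach_prob_def path_measure_def Sigma_Algebra.measure_def
    using nonneg[OF s0] by (simp add: enn2real_leI)
qed

section \<open>Correctness of the penalty method\<close>

theorem theorem2:
  fixes M :: "('s, 'a, 'v) pmdp" and T :: "'s set"
    and lam eps_graph tau :: real
    and t :: "'s \<Rightarrow> 'a \<Rightarrow> real"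
    and xhat x :: "'s + 'v \<Rightarrow> real"
    and k :: "'s \<Rightarrow> 'a \<Rightarrow> real"
  assumes "affine_pmdp M"
    and "T \<subseteq> states M"
    and "lam \<in> {0..1}"
    and "eps_graph > 0"
    and "tau > 0"
    and "\<And>s \<alpha>. s \<in> states M - T \<Longrightarrow> \<alpha> \<in> enabled M s \<Longrightarrow>
           t s \<alpha> > 0 \<and> pos_semidef (qp_index M) (P_plus M (t s \<alpha>) s \<alpha>)"
    and "\<And>s. s \<in> states M \<Longrightarrow> x (Inl s) \<in> {0..1}"
    and "\<And>s. s \<in> T \<Longrightarrow> x (Inl s) = 1"
    and "\<And>s s' \<alpha>. s \<in> states M \<Longrightarrow> s' \<in> states M \<Longrightarrow> \<alpha> \<in> enabled M s \<Longrightarrow>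
           transf M s \<alpha> s' \<noteq> 0 \<Longrightarrow> poly_value (x \<circ> Inr) (transf M s \<alpha> s') \<ge> eps_graph"
    and "\<And>s \<alpha>. s \<in> states M \<Longrightarrow> \<alpha> \<in> enabled M s \<Longrightarrow>
           (\<Sum>s'\<in>states M. poly_value (x \<circ> Inr) (transf M s \<alpha> s')) = 1"
    and "lam \<ge> x (Inl (init M))"
    and "\<And>s \<alpha>. s \<in> states M - T \<Longrightarrow> \<alpha> \<in> enabled M s \<Longrightarrow>
           k s \<alpha> + x (Inl s) \<ge>
             dot (qp_index M) x (mat_vec (qp_index M) (P_plus M (t s \<alpha>) s \<alpha>) x) + dot (qp_index M) (q_vec M s \<alpha>) x
             - dot (qp_index M) xhat (mat_vec (qp_index M) (P_minus (t s \<alpha>)) (\<lambda>i. 2 * x i - xhat i))"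
    and "\<And>s \<alpha>. s \<in> states M - T \<Longrightarrow> \<alpha> \<in> enabled M s \<Longrightarrow> k s \<alpha> \<ge> 0"
    and "tau * (\<Sum>s\<in>states M - T. \<Sum>\<alpha>\<in>enabled M s. k s \<alpha>) = 0"
  shows "well_defined M (x \<circ> Inr) \<and> sat_reach_le (inst M (x \<circ> Inr)) lam T"
proof -
  let ?D = "inst M (x \<circ> Inr)"
  let ?f = "\<lambda>s \<alpha> s'. poly_value (x \<circ> Inr) (transf M s \<alpha> s')"
  have wf: "wf_process M"
    using assms(1) by (simp add: affine_pmdp_def is_pmdp_def)
  then have finS: "finite (states M)" and init: "init M \<in> states M" and finA: "finite (acts M)"
    by (auto simp: wf_process_def)
  have enabled_acts: "\<alpha> \<in> acts M" if "\<alpha> \<in> enabled M s" for s \<alpha>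
    using that by (simp add: enabled_def)
  have finE: "finite (enabled M s)" for s
    using finA by (simp add: enabled_def)
  have pos: "0 < ?f s \<alpha> s'" if "s \<in> states M" "\<alpha> \<in> acts M" "s' \<in> states M" "transf M s \<alpha> s' \<noteq> 0"
    for s \<alpha> s'
    using that assms(4) by (intro less_le_trans[OF _ assms(9)]) (auto simp: enabled_def)
  then have nonneg: "0 \<le> ?f s \<alpha> s'" if "s \<in> states M" "\<alpha> \<in> acts M" "s' \<in> states M" for s \<alpha> s'
    using that by (cases "transf M s \<alpha> s' = 0") (auto intro: less_imp_le)
  \<comment> \<open>Nonzero polynomials evaluate to at least \<open>eps_graph\<close>, and the zero
    polynomial to 0, so instantiation preserves the graph.\<close>
  have enabled: "enabled ?D s = enabled M s" if "s \<in> states M" for s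
    using pos that by (force simp: enabled_def inst_def)
  \<comment> \<open>An enabled row is nonnegative with sum 1. \<open>is_mdp\<close> also bounds the
    rows of disabled actions, and these vanish.\<close>
  have le_1: "?f s \<alpha> s' \<le> 1" if "s \<in> states M" "\<alpha> \<in> acts M" "s' \<in> states M" for s \<alpha> s'
  proof (cases "\<alpha> \<in> enabled M s")
    case True
    then show ?thesis
      using member_le_sum[of s' "states M" "?f s \<alpha>"] that nonneg finS assms(10)[of s \<alpha>] by auto
  next
    case False
    then have "transf M s \<alpha> s' = 0"
      using that by (auto simp: enabled_def)
    then show ?thesis by simp
  qed
  have wf_D: "wf_process ?D"
    using wf enabled by (simp add: wf_process_def) (simp add: inst_def)
  have well_defined: "well_defined M (x \<circ> Inr)"
    using wf_D nonneg le_1 assms(10) enabled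
    by (simp add: well_defined_def is_mdp_def) (simp add: inst_def)
  \<comment> \<open>A vanishing sum of nonnegative terms has only zero terms; this is applied first
    over states, then over actions.\<close>
  have k0: "k s \<alpha> = 0" if "s \<in> states M - T" "\<alpha> \<in> enabled M s" for s \<alpha>
  proof -
    have "(\<Sum>s\<in>states M - T. \<Sum>\<alpha>\<in>enabled M s. k s \<alpha>) = 0"
      using assms(5,14) by simp
    then have "(\<Sum>\<alpha>\<in>enabled M s. k s \<alpha>) = 0"
      using that finS assms(13) by (subst (asm) sum_nonneg_eq_0_iff) (auto intro: sum_nonneg)
    then show ?thesis
      using that finE assms(13) by (subst (asm) sum_nonneg_eq_0_iff) auto
  qed
  \<comment> \<open>The convexification error is \<open>t s \<alpha>\<close> times a sum of squares,
    so dropping it preserves the inequality.\<close>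
  have bellman: "(\<Sum>s'\<in>states M. ?f s \<alpha> s' * x (Inl s')) \<le> x (Inl s)"
    if "s \<in> states M - T" "\<alpha> \<in> enabled M s" for s \<alpha>
  proof -
    have "0 \<le> t s \<alpha> * (\<Sum>i\<in>qp_index M. (x i - xhat i)\<^sup>2)"
      using assms(6)[OF that] by (intro mult_nonneg_nonneg sum_nonneg) auto
    then show ?thesis
      using assms(12)[OF that] k0[OF that] that enabled_acts[OF that(2)]
      by (simp add: convexified_constraint_eq[OF assms(1)])
  qed
  have "reach_prob (states ?D) (induced_chain ?D \<sigma>) (init ?D) T \<le> lam" if "strategy ?D \<sigma>" for \<sigma>
  proof -
    have \<sigma>: "\<sigma> s \<in> enabled M s" if "s \<in> states M" for s
      using \<open>strategy ?D \<sigma>\<close> that enabled by (auto simp: strategy_def inst_def)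
    have chain_eq: "induced_chain ?D \<sigma> = (\<lambda>s. ?f s (\<sigma> s))"
      by (intro ext) (simp add: induced_chain_def inst_def)
    have "is_chain (states M) (\<lambda>s. ?f s (\<sigma> s))"
      using finS \<sigma> nonneg enabled_acts[OF \<sigma>] assms(10) by (auto simp: is_chain_def)
    then have "reach_prob (states M) (\<lambda>s. ?f s (\<sigma> s)) (init M) T \<le> x (Inl (init M))"
      using init assms(7,8) bellman \<sigma> by (intro reach_prob_le_supersolution) auto
    then show ?thesis
      using assms(11) unfolding chain_eq by (simp add: inst_def)
  qed
  with well_defined show ?thesis
    by (simp add: sat_reach_le_def)
qed

end
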